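(* Let $\tilde g$ be a Riemannian metric on $\mathbb{D}_{++}^{n}$, let $g$ be the product metric on $\mathcal{L}_{++}^{n}$ given by $\{\mathcal{L}_{++}^{n},g\}=\{\mathcal{SL}^n,g^{\mathrm E}\}\times\{\mathbb{D}_{++}^{n},\tilde g\}$, and for $\theta\neq0$ let $g^\theta$ be its diagonal-power-deformed metric (defined in the context). Then for all $L\in\mathcal{L}_{++}^{n}$ and $X,Y\in T_L\mathcal{L}_{++}^{n}$, $$g^\theta_L(X,Y)=\langle\lfloor X\rfloor,\lfloor Y\rfloor\rangle+\tilde g_{\mathbb{L}^\theta}\left(\mathbb{L}^{\theta-1}\mathbb{X},\mathbb{L}^{\theta-1}\mathbb{Y}\right),$$ and $$\lim_{\theta\to0}g^\theta_L(X,Y)=\langle\lfloor X\rfloor,\lfloor Y\rfloor\rangle+\tilde g_I\left(\mathbb{L}^{-1}\mathbb{X},\mathbb{L}^{-1}\mathbb{Y}\right).$$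
   Context: $\mathcal{L}_{++}^{n}$ is the manifold of real $n\times n$ lower triangular matrices with positive diagonal entries (open in the space of lower triangular matrices, which is identified with each tangent space). $\mathcal{SL}^n$ is the Euclidean space of strictly lower triangular $n\times n$ matrices with the standard Euclidean (Frobenius) metric $g^{\mathrm E}=\langle\cdot,\cdot\rangle$; $\mathbb{D}_{++}^{n}$ is the manifold of $n\times n$ diagonal matrices with positive diagonal entries. For a square matrix $A$, $\lfloor A\rfloor$ is its strictly lower triangular part and the blackboard-bold letter $\mathbb{A}$ is the diagonal matrix with the diagonal entries of $A$. A matrix $L\in\mathcal{L}_{++}^n$ is identified with the pair $(\lfloor L\rfloor,\mathbb{L})\in\mathcal{SL}^n\times\mathbb{D}_{++}^{n}$. For $\theta\ne0$, $\operatorname{DPow}_\theta:\mathbb{D}_{++}^{n}\to\mathbb{D}_{++}^{n}$, $\mathbb{P}\mapsto\mathbb{P}^\theta$ (entrywise power of the diagonal). The diagonal-power-deformed metric of $g$ is defined by $\{\mathcal{L}_{++}^{n},g^\theta\}=\{\mathcal{SL}^n,g^{\mathrm E}\}\times\{\mathbb{D}_{++}^{n},\frac{1}{\theta^2}\operatorname{DPow}_\theta^*\tilde g\}$, where $f^*\tilde g$ is the pullback metric $(f^*\tilde g)_P(V,W)=\tilde g_{f(P)}(f_{*,P}V,f_{*,P}W)$. *)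

theory Defs
  imports "HOL-Analysis.Analysis"
begin

text \<open>
  An \<open>n \<times> n\<close> matrix has type \<open>'n sqmat\<close> with \<open>'n :: {finite, linorder}\<close>; the linear order on the
  index type gives triangularity its meaning, and \<open>n = CARD('n)\<close>.  The inner product \<open>\<bullet>\<close> on this
  type is the Frobenius inner product.
\<close>

type_synonym 'n sqmat = "real^'n^'n"

definition lower_tri :: "('n::{finite, linorder} sqmat) set" where
  "lower_tri = {A. \<forall>i j. i < j \<longrightarrow> A $ i $ j = 0}"

definition diag_mats :: "('n::finite sqmat) set" where
  "diag_mats = {A. \<forall>i j. i \<noteq> j \<longrightarrow> A $ i $ j = 0}"

definition lower_tri_pos :: "('n::{finite, linorder} sqmat) set" where
  "lower_tri_pos = {A \<in> lower_tri. \<forall>i. A $ i $ i > 0}"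

definition diag_pos :: "('n::finite sqmat) set" where
  "diag_pos = {A \<in> diag_mats. \<forall>i. A $ i $ i > 0}"

definition strict_lower :: "'n::{finite, linorder} sqmat \<Rightarrow> 'n::{finite, linorder} sqmat" where
  "strict_lower A = (\<chi> i j. if j < i then A $ i $ j else 0)"

definition diag_part :: "'n::finite sqmat \<Rightarrow> 'n::finite sqmat" where
  "diag_part A = (\<chi> i j. if i = j then A $ i $ j else 0)"

definition diag_pow :: "real \<Rightarrow> 'n::finite sqmat \<Rightarrow> 'n::finite sqmat" where
  "diag_pow \<theta> P = (\<chi> i j. if i = j then (P $ i $ i) powr \<theta> else 0)"

text \<open>
  All manifolds here are relatively open subsets \<open>M\<close> of a linear subspace \<open>T\<close>, and every tangent
  space is identified with \<open>T\<close>.  A field of bilinear forms is a total function of which only the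
  values at points of \<open>M\<close> and vectors of \<open>T\<close> are meaningful.  A derivative within \<open>M\<close> is uniquely
  determined on \<open>T\<close> (and only there), so it is applied to vectors of \<open>T\<close> only.
\<close>

type_synonym 'a form_field = "'a \<Rightarrow> 'a \<Rightarrow> 'a \<Rightarrow> real"

fun Ck_within :: "nat \<Rightarrow> 'a::euclidean_space set \<Rightarrow> 'a set \<Rightarrow> ('a \<Rightarrow> real) \<Rightarrow> bool" where
  "Ck_within 0 M T f \<longleftrightarrow> continuous_on M f"
| "Ck_within (Suc k) M T f \<longleftrightarrow> f differentiable_on M \<and>
     (\<forall>v\<in>T. Ck_within k M T (\<lambda>x. frechet_derivative f (at x within M) v))"

definition inner_product_on :: "'a::real_vector set \<Rightarrow> ('a \<Rightarrow> 'a \<Rightarrow> real) \<Rightarrow> bool" where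
  "inner_product_on T b \<longleftrightarrow>
     (\<forall>u\<in>T. \<forall>v\<in>T. \<forall>w\<in>T. b (u + v) w = b u w + b v w) \<and>
     (\<forall>c. \<forall>v\<in>T. \<forall>w\<in>T. b (c *\<^sub>R v) w = c * b v w) \<and>
     (\<forall>v\<in>T. \<forall>w\<in>T. b v w = b w v) \<and>
     (\<forall>v\<in>T. v \<noteq> 0 \<longrightarrow> b v v > 0)"

definition riemannian_metric :: "'a::euclidean_space set \<Rightarrow> 'a set \<Rightarrow> 'a form_field \<Rightarrow> bool" where
  "riemannian_metric M T g \<longleftrightarrow>
     (\<forall>P\<in>M. inner_product_on T (g P)) \<and>
     (\<forall>V\<in>T. \<forall>W\<in>T. \<forall>k. Ck_within k M T (\<lambda>P. g P V W))"

definition pullback :: "'a::euclidean_space set \<Rightarrow> ('a \<Rightarrow> 'b::euclidean_space) \<Rightarrow> 'b form_field \<Rightarrow> 'a form_field" where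
  "pullback M f g P V W =
     g (f P) (frechet_derivative f (at P within M) V) (frechet_derivative f (at P within M) W)"

definition product_metric :: "'a form_field \<Rightarrow> 'b form_field \<Rightarrow> ('a \<times> 'b) form_field" where
  "product_metric g h p v w = g (fst p) (fst v) (fst w) + h (snd p) (snd v) (snd w)"

definition euclidean_metric :: "'a::euclidean_space form_field" where
  "euclidean_metric P V W = V \<bullet> W"

definition tri_split :: "'n::{finite, linorder} sqmat \<Rightarrow> ('n::{finite, linorder} sqmat) \<times> ('n::{finite, linorder} sqmat)" where
  "tri_split A = (strict_lower A, diag_part A)"

text \<open>
  The metric on \<open>lower_tri_pos\<close> that corresponds to the product of the Euclidean metric on the
  strictly lower triangular matrices and the metric \<open>h\<close> on \<open>diag_pos\<close>.  The identification
  \<open>tri_split\<close> is linear, hence equal to its own differential, so it also acts on tangent vectors.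
\<close>

definition tri_product_metric ::
    "('n::{finite, linorder} sqmat) form_field \<Rightarrow> ('n::{finite, linorder} sqmat) form_field" where
  "tri_product_metric h L X Y =
     product_metric euclidean_metric h (tri_split L) (tri_split X) (tri_split Y)"

definition is_tri_product_metric ::
    "('n::{finite, linorder} sqmat) form_field \<Rightarrow> ('n::{finite, linorder} sqmat) form_field \<Rightarrow> bool" where
  "is_tri_product_metric h g \<longleftrightarrow>
     (\<forall>L\<in>lower_tri_pos. \<forall>X\<in>lower_tri. \<forall>Y\<in>lower_tri. g L X Y = tri_product_metric h L X Y)"

text \<open>
  \<open>g'\<close> is the diagonal-power-deformed metric of \<open>g\<close>.  The witness \<open>h\<close> is the diagonal factor of
  \<open>g\<close>; it is determined by \<open>g\<close> on \<open>diag_pos\<close>, and hence so is \<open>g'\<close> on \<open>lower_tri_pos\<close>.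
\<close>

definition is_diag_pow_deformed ::
    "real \<Rightarrow> ('n::{finite, linorder} sqmat) form_field \<Rightarrow> ('n::{finite, linorder} sqmat) form_field \<Rightarrow> bool" where
  "is_diag_pow_deformed \<theta> g g' \<longleftrightarrow>
     (\<exists>h. riemannian_metric diag_pos diag_mats h \<and> is_tri_product_metric h g \<and>
          is_tri_product_metric
            (\<lambda>P V W. 1 / \<theta>\<^sup>2 * pullback diag_pos (diag_pow \<theta>) h P V W) g')"

end

theory Submission
  imports Defs
begin

text \<open>
  The differential of \<open>diag_pow \<theta>\<close> at \<open>P\<close> maps a diagonal \<open>V\<close> to \<open>\<theta>\<close> times
  \<open>diag_pow (\<theta> - 1) P ** V\<close>, so by bilinearity the two factors \<open>\<theta>\<close> cancel the normalisation
  \<open>1 / \<theta>\<^sup>2\<close>.  For the limit, expand in a basis of the diagonal matrices: the coefficients of the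
  metric are continuous at the identity, to which \<open>diag_pow \<theta> P\<close> converges.
\<close>

section \<open>Directional values of derivatives within a set\<close>

text \<open>On a set that is not open, several linear maps may be derivatives of \<open>f\<close> at
  \<open>x\<close>. Restricting \<open>f\<close> to the line through \<open>x\<close> in direction
  \<open>v\<close> gives a function of one real variable near the interior point 0, whose derivative
  is unique; hence all candidates agree at \<open>v\<close>.\<close>

lemma frechet_derivative_within_eq:
  assumes D: "(f has_derivative D) (at x within S)"
    and S: "eventually (\<lambda>t::real. x + t *\<^sub>R v \<in> S) (nhds 0)"
  shows "frechet_derivative f (at x within S) v = D v"
proof -
  obtain U where U: "open U" "0 \<in> U" "\<And>t. t \<in> U \<Longrightarrow> x + t *\<^sub>R v \<in> S"
    using S by (auto simp: eventually_nhds)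
  have *: "((\<lambda>t. f (x + t *\<^sub>R v)) has_derivative (\<lambda>t. E (t *\<^sub>R v))) (at 0)"
    if E: "(f has_derivative E) (at x within S)" for E
  proof -
    have 1: "((\<lambda>t. x + t *\<^sub>R v) has_derivative (\<lambda>t. t *\<^sub>R v)) (at 0 within U)"
      by (auto intro!: derivative_eq_intros)
    \<comment> \<open>The segment lies in \<open>S\<close>, so the derivative within
      \<open>S\<close> restricts to it; since \<open>U\<close> is open, the chain rule then yields a
      full derivative at 0.\<close>
    have 2: "(f has_derivative E) (at (x + 0 *\<^sub>R v) within (\<lambda>t. x + t *\<^sub>R v) ` U)"
      unfolding scaleR_zero_left add_0_right
      by (rule has_derivative_subset[OF E]) (use U(3) in blast)
    show ?thesis
      using has_derivative_in_compose[OF 1 2] unfolding at_within_open[OF U(2,1)] .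
  qed
  have "(f has_derivative frechet_derivative f (at x within S)) (at x within S)"
    using differentiableI[OF D] unfolding frechet_derivative_works .
  from fun_cong[OF has_derivative_unique[OF *[OF this] *[OF D]], of 1] show ?thesis
    by simp
qed

section \<open>Bilinear forms and their limits\<close>

text \<open>An inner product on \<open>T\<close> is unconstrained outside \<open>T\<close>.
  Composing it with a linear map into \<open>T\<close> makes it bilinear on a whole space, where the
  general facts about \<open>bilinear\<close> apply.\<close>

lemma inner_product_on_bilinear:
  fixes e :: "'a::real_vector \<Rightarrow> 'b::real_vector"
  assumes b: "inner_product_on T b" and e: "linear e" and T: "\<And>v. e v \<in> T"
  shows "bilinear (\<lambda>v w. b (e v) (e w))"
proof -
  have add: "b (e u + e v) (e w) = b (e u) (e w) + b (e v) (e w)"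
    and scale: "b (c *\<^sub>R e v) (e w) = c * b (e v) (e w)"
    and sym: "b (e v) (e w) = b (e w) (e v)" for u v w c
    using b T by (simp_all add: inner_product_on_def)
  have 1: "linear (\<lambda>v. b (e v) (e w))" for w
    by (rule linearI) (simp_all add: linear_add[OF e] linear_scale[OF e] add scale)
  \<comment> \<open>\<open>inner_product_on\<close> postulates linearity in the first argument;
    symmetry carries it to the second.\<close>
  have 2: "(\<lambda>w. b (e v) (e w)) = (\<lambda>w. b (e w) (e v))" for v
    by (rule ext) (rule sym)
  show ?thesis
    unfolding bilinear_def by (intro conjI allI 1) (simp only: 2 1)
qed

text \<open>In a basis the value is a finite sum of products of coordinates and coefficients, each
  of which converges. Form and arguments may thus vary together.\<close>

lemma tendsto_bilinear:
  fixes B :: "'t \<Rightarrow> 'a::euclidean_space \<Rightarrow> 'b::euclidean_space \<Rightarrow> real"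
  assumes B: "\<And>t. bilinear (B t)" and B0: "bilinear B0"
    and lim: "\<And>i j. i \<in> Basis \<Longrightarrow> j \<in> Basis \<Longrightarrow> ((\<lambda>t. B t i j) \<longlongrightarrow> B0 i j) F"
    and f: "(f \<longlongrightarrow> f0) F" and g: "(g \<longlongrightarrow> g0) F"
  shows "((\<lambda>t. B t (f t) (g t)) \<longlongrightarrow> B0 f0 g0) F"
proof -
  have expand: "b v w = (\<Sum>(i, j)\<in>Basis \<times> Basis. (v \<bullet> i) * (w \<bullet> j) * b i j)"
    if b: "bilinear b" for b :: "'a \<Rightarrow> 'b \<Rightarrow> real" and v w
  proof -
    have "b v w = b (\<Sum>i\<in>Basis. (v \<bullet> i) *\<^sub>R i) (\<Sum>j\<in>Basis. (w \<bullet> j) *\<^sub>R j)"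
      by (simp add: euclidean_representation)
    also have "\<dots> = (\<Sum>(i, j)\<in>Basis \<times> Basis. (v \<bullet> i) * (w \<bullet> j) * b i j)"
      by (simp add: bilinear_sum[OF b] bilinear_lmul[OF b] bilinear_rmul[OF b] ac_simps)
    finally show ?thesis .
  qed
  have "((\<lambda>t. \<Sum>(i, j)\<in>Basis \<times> Basis. (f t \<bullet> i) * (g t \<bullet> j) * B t i j) \<longlongrightarrow>
      (\<Sum>(i, j)\<in>Basis \<times> Basis. (f0 \<bullet> i) * (g0 \<bullet> j) * B0 i j)) F"
    unfolding case_prod_unfold by (intro tendsto_intros f g lim) auto
  then show ?thesis
    by (simp only: expand[OF B, of _ "f _" "g _"] expand[OF B0, of f0 g0])
qed

section \<open>Diagonal matrices, their powers and inverses\<close>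

text \<open>A linear parametrisation of \<open>diag_mats\<close> by vectors; it turns forms on that
  subspace into bilinear forms on all of \<open>real^'n\<close>.\<close>

definition diag_mat :: "real^'n \<Rightarrow> real^'n^'n" where
  "diag_mat v = (\<chi> i j. if i = j then v $ i else 0)"

lemma diag_mat_nth: "diag_mat v $ i $ j = (if i = j then v $ i else 0)"
  by (simp add: diag_mat_def)

lemma linear_diag_mat: "linear diag_mat"
  by (rule linearI) (simp_all add: vec_eq_iff diag_mat_nth)

lemma diag_mat_mult: "diag_mat v ** diag_mat w = diag_mat (\<chi> i. v $ i * w $ i)"
proof -
  have "(\<Sum>k\<in>UNIV. diag_mat v $ i $ k * diag_mat w $ k $ j) =
      (\<Sum>k\<in>UNIV. if k = i then v $ i * diag_mat w $ i $ j else 0)" for i j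
    by (rule sum.cong) (auto simp: diag_mat_nth)
  then show ?thesis
    by (simp add: vec_eq_iff matrix_matrix_mult_def sum.delta) (simp add: diag_mat_nth)
qed

lemma diag_mat_in [simp]: "diag_mat v \<in> diag_mats"
  by (simp add: diag_mats_def diag_mat_nth)

lemma diag_mats_eq: "A \<in> diag_mats \<Longrightarrow> diag_mat (\<chi> i. A $ i $ i) = A"
  by (auto simp: diag_mats_def diag_mat_nth vec_eq_iff)

lemma diag_part_eq: "diag_part A = diag_mat (\<chi> i. A $ i $ i)"
  by (simp add: diag_part_def diag_mat_nth vec_eq_iff)

lemma diag_pow_eq: "diag_pow \<theta> P = diag_mat (\<chi> i. P $ i $ i powr \<theta>)"
  by (simp add: diag_pow_def diag_mat_nth vec_eq_iff)

lemma diag_mats_subset_lower_tri: "diag_mats \<subseteq> lower_tri"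
  by (auto simp: diag_mats_def lower_tri_def)

lemma diag_pos_subset_lower_tri_pos: "diag_pos \<subseteq> lower_tri_pos"
  using diag_mats_subset_lower_tri by (auto simp: diag_pos_def lower_tri_pos_def)

lemma diag_pow_in_diag_pos: "P \<in> diag_pos \<Longrightarrow> diag_pow \<theta> P \<in> diag_pos"
  by (simp add: diag_pos_def diag_pow_eq diag_mat_nth less_imp_neq[symmetric])

lemma diag_part_in_diag_pos: "L \<in> lower_tri_pos \<Longrightarrow> diag_part L \<in> diag_pos"
  by (simp add: diag_pos_def lower_tri_pos_def diag_part_eq diag_mat_nth)

text \<open>Positivity matters here, because \<open>0 powr 0 = 0\<close>.\<close>

lemma diag_pow_zero: "P \<in> diag_pos \<Longrightarrow> diag_pow 0 P = mat 1"
  by (auto simp: diag_pos_def diag_pow_def mat_def vec_eq_iff less_imp_neq[symmetric])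

lemma matrix_inv_diag_pos:
  assumes "P \<in> diag_pos"
  shows "matrix_inv P = diag_pow (-1) P"
proof -
  have pos: "P $ i $ i > 0" for i
    using assms by (simp add: diag_pos_def)
  have P: "P = diag_mat (\<chi> i. P $ i $ i)"
    using assms by (simp add: diag_pos_def diag_mats_eq)
  have inv: "diag_mat (\<chi> i. P $ i $ i powr (-1)) ** diag_mat (\<chi> i. P $ i $ i) = mat 1"
    "diag_mat (\<chi> i. P $ i $ i) ** diag_mat (\<chi> i. P $ i $ i powr (-1)) = mat 1"
    by (auto simp: diag_mat_mult powr_minus less_imp_neq[OF pos, symmetric] abs_of_pos[OF pos]
        diag_mat_nth mat_def vec_eq_iff)
  then have inv: "P ** diag_pow (-1) P = mat 1" "diag_pow (-1) P ** P = mat 1"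
    by (simp_all only: diag_pow_eq flip: P)
  \<comment> \<open>\<open>matrix_inv\<close> is a choice among two-sided inverses; the inverse just
    found shows that the choice satisfies its specification, and associativity then identifies the
    two.\<close>
  then have left: "matrix_inv P ** P = mat 1"
    unfolding matrix_inv_def by (metis (mono_tags, lifting) someI_ex)
  have "matrix_inv P = matrix_inv P ** (P ** diag_pow (-1) P)"
    by (simp only: inv matrix_mul_rid)
  also have "\<dots> = diag_pow (-1) P"
    by (simp only: matrix_mul_assoc left matrix_mul_lid)
  finally show ?thesis .
qed

section \<open>The differential of the diagonal power map\<close>

lemma has_derivative_matrixI:
  fixes f :: "'a::real_normed_vector \<Rightarrow> real^'n^'m"
  assumes "\<And>i j. ((\<lambda>x. f x $ i $ j) has_derivative (\<lambda>x. D x $ i $ j)) (at x within S)"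
  shows "(f has_derivative D) (at x within S)"
  using assms by (subst has_derivative_componentwise_within) (auto simp: Basis_vec_def inner_axis)

text \<open>Each diagonal entry follows the power rule. As \<open>diag_pow\<close> reads only
  diagonal entries, the formula takes the diagonal of \<open>V\<close> and is valid in all matrix
  directions.\<close>

lemma has_derivative_diag_pow:
  fixes P :: "real^'n^'n"
  assumes P: "P \<in> diag_pos"
  shows "(diag_pow \<theta> has_derivative
           (\<lambda>V. \<theta> *\<^sub>R (diag_pow (\<theta> - 1) P ** diag_mat (\<chi> i. V $ i $ i)))) (at P within S)"
proof -
  have pos: "P $ i $ i > 0" for i
    using P by (simp add: diag_pos_def)
  have nth: "((\<lambda>Q. Q $ i $ i) has_derivative (\<lambda>V. V $ i $ i)) (at P)" for i :: 'n
    by (rule bounded_linear_imp_has_derivative)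
      (rule bounded_linear_compose[OF bounded_linear_vec_nth bounded_linear_vec_nth])
  have entry: "((\<lambda>Q. Q $ i $ i powr \<theta>) has_derivative
      (\<lambda>V. \<theta> * (P $ i $ i powr (\<theta> - 1) * V $ i $ i))) (at P)" for i :: 'n
    by (rule has_derivative_eq_rhs[OF has_derivative_powr[OF nth has_derivative_const pos UNIV_I]])
      (use pos[of i] in \<open>simp add: powr_diff fun_eq_iff\<close>)
  have "((\<lambda>Q. diag_pow \<theta> Q $ i $ j) has_derivative
      (\<lambda>V. (\<theta> *\<^sub>R (diag_pow (\<theta> - 1) P ** diag_mat (\<chi> i. V $ i $ i))) $ i $ j)) (at P)" for i j
  proof (cases "i = j")
    case True
    then show ?thesis
      using entry[of i] by (simp only: diag_pow_eq diag_mat_mult diag_mat_nth vector_scaleR_component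
          vec_lambda_beta real_scaleR_def if_True simp_thms)
  next
    case False
    then show ?thesis
      by (simp only: diag_pow_eq diag_mat_mult diag_mat_nth vector_scaleR_component
          if_False scaleR_zero_right has_derivative_const)
  qed
  then have "(diag_pow \<theta> has_derivative
      (\<lambda>V. \<theta> *\<^sub>R (diag_pow (\<theta> - 1) P ** diag_mat (\<chi> i. V $ i $ i)))) (at P)"
    by (rule has_derivative_matrixI)
  then show ?thesis
    by (rule has_derivative_at_withinI)
qed

text \<open>For diagonal \<open>V\<close> the point \<open>P + t *\<^sub>R V\<close> stays in
  \<open>diag_pos\<close> for small \<open>t\<close>, since finitely many positive entries remain
  positive. This pins down the derivative at \<open>V\<close>.\<close>

lemma frechet_derivative_diag_pow:
  assumes P: "P \<in> diag_pos" and V: "V \<in> diag_mats"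
  shows "frechet_derivative (diag_pow \<theta>) (at P within diag_pos) V =
         \<theta> *\<^sub>R (diag_pow (\<theta> - 1) P ** V)"
proof -
  have pos: "P $ i $ i > 0" for i
    using P by (simp add: diag_pos_def)
  have "\<forall>\<^sub>F t in nhds 0. P $ i $ i + t * V $ i $ i > 0" for i
  proof -
    have "((\<lambda>t. P $ i $ i + t * V $ i $ i) \<longlongrightarrow> P $ i $ i + 0 * V $ i $ i) (nhds 0)"
      by (intro tendsto_intros filterlim_ident)
    then show ?thesis
      using pos[of i] by (simp add: order_tendstoD(1))
  qed
  then have "\<forall>\<^sub>F t in nhds 0. \<forall>i. P $ i $ i + t * V $ i $ i > 0"
    by (simp add: eventually_all_finite)
  then have "\<forall>\<^sub>F t in nhds 0. P + t *\<^sub>R V \<in> diag_pos"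
    by (rule eventually_mono) (use P V in \<open>auto simp: diag_pos_def diag_mats_def\<close>)
  from frechet_derivative_within_eq[OF has_derivative_diag_pow[OF P] this]
  show ?thesis
    by (simp add: diag_mats_eq V)
qed

section \<open>Product metrics and the formula for the deformed metric\<close>

lemma tri_product_metric_eq:
  "tri_product_metric h L X Y =
   strict_lower X \<bullet> strict_lower Y + h (diag_part L) (diag_part X) (diag_part Y)"
  by (simp add: tri_product_metric_def product_metric_def euclidean_metric_def tri_split_def)

text \<open>Diagonal matrices also lie in the triangular spaces, so \<open>g\<close> can be
  evaluated on them; the strictly lower terms of the two expressions cancel.\<close>

lemma is_tri_product_metric_diag_factor_unique:
  assumes h: "is_tri_product_metric h g" "is_tri_product_metric k g"
    and P: "P \<in> diag_pos" and V: "V \<in> diag_mats" and W: "W \<in> diag_mats"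
  shows "h P V W = k P V W"
proof -
  have "tri_product_metric h P V W = tri_product_metric k P V W"
    using h subsetD[OF diag_pos_subset_lower_tri_pos P] subsetD[OF diag_mats_subset_lower_tri V]
      subsetD[OF diag_mats_subset_lower_tri W]
    unfolding is_tri_product_metric_def by force
  then show ?thesis
    using P V W by (simp add: tri_product_metric_eq diag_part_eq diag_mats_eq diag_pos_def)
qed

lemma pullback_diag_pow:
  assumes h: "riemannian_metric diag_pos diag_mats h" and \<theta>: "\<theta> \<noteq> 0"
    and P: "P \<in> diag_pos" and V: "V \<in> diag_mats" and W: "W \<in> diag_mats"
  shows "1 / \<theta>\<^sup>2 * pullback diag_pos (diag_pow \<theta>) h P V W =
         h (diag_pow \<theta> P) (diag_pow (\<theta> - 1) P ** V) (diag_pow (\<theta> - 1) P ** W)"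
proof -
  have in_diag: "diag_pow (\<theta> - 1) P ** U \<in> diag_mats" if "U \<in> diag_mats" for U
    by (subst diag_mats_eq[OF that, symmetric]) (simp add: diag_pow_eq diag_mat_mult)
  have "inner_product_on diag_mats (h (diag_pow \<theta> P))"
    using h P by (simp add: riemannian_metric_def diag_pow_in_diag_pos)
  note bil = inner_product_on_bilinear[OF this linear_diag_mat diag_mat_in]
  \<comment> \<open>Both arguments are diagonal, so they come from vectors and \<open>bil\<close>
    can extract the scalars.\<close>
  obtain v w where vw: "diag_pow (\<theta> - 1) P ** V = diag_mat v"
      "diag_pow (\<theta> - 1) P ** W = diag_mat w"
    by (rule that[OF diag_mats_eq[OF in_diag[OF V], symmetric]
          diag_mats_eq[OF in_diag[OF W], symmetric]])
  have "pullback diag_pos (diag_pow \<theta>) h P V W =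
      h (diag_pow \<theta> P) (diag_mat (\<theta> *\<^sub>R v)) (diag_mat (\<theta> *\<^sub>R w))"
    by (simp only: pullback_def frechet_derivative_diag_pow[OF P V]
        frechet_derivative_diag_pow[OF P W] vw linear_scale[OF linear_diag_mat])
  also have "\<dots> = \<theta>\<^sup>2 * h (diag_pow \<theta> P) (diag_mat v) (diag_mat w)"
    by (simp only: bilinear_lmul[OF bil] bilinear_rmul[OF bil] real_scaleR_def
        power2_eq_square mult.assoc)
  finally show ?thesis
    using \<theta> by (simp add: vw)
qed

lemma diag_pow_deformed_eq:
  assumes gt: "is_tri_product_metric gt g"
    and g': "is_diag_pow_deformed \<theta> g g'" and \<theta>: "\<theta> \<noteq> 0"
    and L: "L \<in> lower_tri_pos" and X: "X \<in> lower_tri" and Y: "Y \<in> lower_tri"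
  shows "g' L X Y = strict_lower X \<bullet> strict_lower Y
           + gt (diag_pow \<theta> (diag_part L))
               (diag_pow (\<theta> - 1) (diag_part L) ** diag_part X)
               (diag_pow (\<theta> - 1) (diag_part L) ** diag_part Y)"
proof -
  obtain h where h: "riemannian_metric diag_pos diag_mats h" "is_tri_product_metric h g"
    and h': "is_tri_product_metric
          (\<lambda>P V W. 1 / \<theta>\<^sup>2 * pullback diag_pos (diag_pow \<theta>) h P V W) g'"
    using g' unfolding is_diag_pow_deformed_def by blast
  note P = diag_part_in_diag_pos[OF L]
  have diag: "diag_part A \<in> diag_mats" for A :: "'a sqmat"
    by (simp add: diag_part_eq)
  have "g' L X Y = tri_product_metric
      (\<lambda>P V W. 1 / \<theta>\<^sup>2 * pullback diag_pos (diag_pow \<theta>) h P V W) L X Y"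
    using h' L X Y unfolding is_tri_product_metric_def by blast
  also have "\<dots> = strict_lower X \<bullet> strict_lower Y
      + h (diag_pow \<theta> (diag_part L)) (diag_pow (\<theta> - 1) (diag_part L) ** diag_part X)
          (diag_pow (\<theta> - 1) (diag_part L) ** diag_part Y)"
    by (simp only: tri_product_metric_eq pullback_diag_pow[OF h(1) \<theta> P diag diag])
  \<comment> \<open>The witness \<open>h\<close> of the deformation and the given \<open>gt\<close>
    are both diagonal factors of \<open>g\<close>, so they agree at this point of
    \<open>diag_pos\<close> on diagonal arguments.\<close>
  also have "h (diag_pow \<theta> (diag_part L)) (diag_pow (\<theta> - 1) (diag_part L) ** diag_part X)
          (diag_pow (\<theta> - 1) (diag_part L) ** diag_part Y) =
      gt (diag_pow \<theta> (diag_part L)) (diag_pow (\<theta> - 1) (diag_part L) ** diag_part X)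
          (diag_pow (\<theta> - 1) (diag_part L) ** diag_part Y)"
    by (rule is_tri_product_metric_diag_factor_unique[OF h(2) gt diag_pow_in_diag_pos[OF P]])
      (simp_all add: diag_pow_eq diag_part_eq diag_mat_mult)
  finally show ?thesis .
qed

section \<open>The limit as \<theta> tends to 0\<close>

lemma tendsto_metric_diag_pow:
  assumes gt: "riemannian_metric diag_pos diag_mats gt"
    and P: "P \<in> diag_pos" and V: "V \<in> diag_mats" and W: "W \<in> diag_mats"
  shows "((\<lambda>\<theta>. gt (diag_pow \<theta> P) (diag_pow (\<theta> - 1) P ** V) (diag_pow (\<theta> - 1) P ** W))
           \<longlongrightarrow> gt (mat 1) (matrix_inv P ** V) (matrix_inv P ** W)) (at 0)"
proof -
  have pos: "P $ i $ i > 0" for i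
    using P by (simp add: diag_pos_def)
  have bil: "bilinear (\<lambda>v w. gt (diag_pow \<theta> P) (diag_mat v) (diag_mat w))" for \<theta>
    using gt P by (intro inner_product_on_bilinear[OF _ linear_diag_mat diag_mat_in])
      (simp add: riemannian_metric_def diag_pow_in_diag_pos)
  \<comment> \<open>The shift \<open>c\<close> covers both uses: 0 for the base point and 1 for the
    factor in front of the tangent vectors.\<close>
  have entry: "((\<lambda>\<theta>. P $ i $ i powr (\<theta> - c)) \<longlongrightarrow> P $ i $ i powr (0 - c)) (at 0)" for i c
    using pos[of i] by (intro tendsto_intros) auto
  have "((\<lambda>\<theta>. \<chi> i. P $ i $ i powr \<theta>) \<longlongrightarrow> (\<chi> i. P $ i $ i powr 0)) (at 0)"
    using entry[of _ 0] by (intro tendsto_vec_lambda) simp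
  then have pow: "((\<lambda>\<theta>. diag_pow \<theta> P) \<longlongrightarrow> diag_pow 0 P) (at 0)"
    unfolding diag_pow_eq
    by (rule bounded_linear.tendsto[OF linear_linear[THEN iffD2, OF linear_diag_mat]])
  have coeff: "((\<lambda>\<theta>. gt (diag_pow \<theta> P) (diag_mat v) (diag_mat w))
      \<longlongrightarrow> gt (diag_pow 0 P) (diag_mat v) (diag_mat w)) (at 0)" for v w
  proof -
    \<comment> \<open>Level 0 of the smoothness condition is continuity of the coefficients; the
      curve \<open>diag_pow \<theta> P\<close> stays in \<open>diag_pos\<close>, as does its
      limit.\<close>
    have "Ck_within 0 diag_pos diag_mats (\<lambda>Q. gt Q (diag_mat v) (diag_mat w))"
      using gt unfolding riemannian_metric_def by (blast intro: diag_mat_in)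
    then have "continuous_on diag_pos (\<lambda>Q. gt Q (diag_mat v) (diag_mat w))"
      by simp
    from continuous_on_tendsto_compose[OF this pow] show ?thesis
      using P by (simp add: diag_pow_in_diag_pos)
  qed
  have "((\<lambda>\<theta>. \<chi> i. P $ i $ i powr (\<theta> - 1) * U $ i $ i)
      \<longlongrightarrow> (\<chi> i. P $ i $ i powr (0 - 1) * U $ i $ i)) (at 0)" for U
    by (intro tendsto_intros entry)
  \<comment> \<open>The second \<open>bil\<close> is the instance at exponent 0, which is the limit
    form.\<close>
  from tendsto_bilinear[OF bil bil coeff this[of V] this[of W]]
  have "((\<lambda>\<theta>. gt (diag_pow \<theta> P)
        (diag_mat (\<chi> i. P $ i $ i powr (\<theta> - 1) * V $ i $ i))
        (diag_mat (\<chi> i. P $ i $ i powr (\<theta> - 1) * W $ i $ i)))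
      \<longlongrightarrow> gt (diag_pow 0 P)
        (diag_mat (\<chi> i. P $ i $ i powr (0 - 1) * V $ i $ i))
        (diag_mat (\<chi> i. P $ i $ i powr (0 - 1) * W $ i $ i))) (at 0)" .
  moreover have "diag_mat (\<chi> i. P $ i $ i powr a * U $ i $ i) = diag_pow a P ** U"
    if "U \<in> diag_mats" for a U
    by (subst (2) diag_mats_eq[OF that, symmetric]) (simp add: diag_pow_eq diag_mat_mult)
  ultimately show ?thesis
    by (simp only: V W diag_pow_zero[OF P] matrix_inv_diag_pos[OF P] diff_0)
qed

theorem lemma3p5:
  fixes gt g :: "('n::{finite, linorder} sqmat) form_field"
    and g\<theta> :: "real \<Rightarrow> ('n::{finite, linorder} sqmat) form_field"
    and L X Y :: "'n::{finite, linorder} sqmat"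
  assumes "riemannian_metric diag_pos diag_mats gt"
    and "is_tri_product_metric gt g"
    and "\<And>\<theta>. \<theta> \<noteq> 0 \<Longrightarrow> is_diag_pow_deformed \<theta> g (g\<theta> \<theta>)"
    and "L \<in> lower_tri_pos" and "X \<in> lower_tri" and "Y \<in> lower_tri"
  shows "(\<forall>\<theta>. \<theta> \<noteq> 0 \<longrightarrow>
           g\<theta> \<theta> L X Y = strict_lower X \<bullet> strict_lower Y
             + gt (diag_pow \<theta> (diag_part L))
                 (diag_pow (\<theta> - 1) (diag_part L) ** diag_part X)
                 (diag_pow (\<theta> - 1) (diag_part L) ** diag_part Y))
       \<and> ((\<lambda>\<theta>. g\<theta> \<theta> L X Y) \<longlongrightarrow>
           strict_lower X \<bullet> strict_lower Y
             + gt (mat 1) (matrix_inv (diag_part L) ** diag_part X)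
                          (matrix_inv (diag_part L) ** diag_part Y)) (at 0)"
proof -
  have formula: "g\<theta> \<theta> L X Y = strict_lower X \<bullet> strict_lower Y
      + gt (diag_pow \<theta> (diag_part L))
          (diag_pow (\<theta> - 1) (diag_part L) ** diag_part X)
          (diag_pow (\<theta> - 1) (diag_part L) ** diag_part Y)" if "\<theta> \<noteq> 0" for \<theta>
    using diag_pow_deformed_eq[OF assms(2) assms(3)[OF that] that assms(4-6)] .
  have "((\<lambda>\<theta>. strict_lower X \<bullet> strict_lower Y
      + gt (diag_pow \<theta> (diag_part L))
          (diag_pow (\<theta> - 1) (diag_part L) ** diag_part X)
          (diag_pow (\<theta> - 1) (diag_part L) ** diag_part Y))
      \<longlongrightarrow> strict_lower X \<bullet> strict_lower Y
        + gt (mat 1) (matrix_inv (diag_part L) ** diag_part X)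
                     (matrix_inv (diag_part L) ** diag_part Y)) (at 0)"
    by (intro tendsto_add tendsto_const tendsto_metric_diag_pow[OF assms(1)]
        diag_part_in_diag_pos[OF assms(4)]) (simp_all add: diag_part_eq)
  \<comment> \<open>The filter \<open>at 0\<close> excludes 0 itself, so the formula for nonzero
    \<theta> transfers the limit whatever \<open>g\<theta> 0\<close> is.\<close>
  then have "((\<lambda>\<theta>. g\<theta> \<theta> L X Y) \<longlongrightarrow> strict_lower X \<bullet> strict_lower Y
        + gt (mat 1) (matrix_inv (diag_part L) ** diag_part X)
                     (matrix_inv (diag_part L) ** diag_part Y)) (at 0)"
    by (rule Lim_transform_eventually) (simp add: eventually_at_filter formula)
  with formula show ?thesis
    by blast
qed

end
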